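(* Let $l=k=1$, i.e. $\mathcal{Y}\subseteq\mathbb{R}$ and $\Theta\subseteq\mathbb{R}$, and for a learning rate $\alpha>0$ let $\phi_{\mathrm{SD}}(y_t,\vartheta_{t|t-1})=\vartheta_{t|t-1}+\alpha\,s(y_t,\vartheta_{t|t-1})$ be the score-driven update. Consider a class $\mathcal{P}$ of true densities and assume: (i) $\mathcal{Y}$ and $\Theta$ are open and convex, $\vartheta_{t|t-1}\in\Theta$ and $\vartheta_{t|t}(y_t)\in\Theta$; (ii) $\log f(x|\vartheta)$ is twice continuously differentiable in $\vartheta$ and Lipschitz continuous in $x$, for all $\vartheta\in\Theta$ and $x\in\mathcal{Y}$; (iii) for all $p_t\in\mathcal{P}$, $p_t(x)$ is Lipschitz continuous in $x$ and bounded for all $x\in\mathcal{Y}$. Then, for any $y_t\in\mathcal{Y}$, $\vartheta_{t|t-1}\in\Theta$ and $p_t\in\mathcal{P}$ such that $\big(p_t(y_t)-f(y_t|\vartheta_{t|t-1})\big)\,s(y_t,\vartheta_{t|t-1})\neq0$, there exist an $\alpha>0$ and a corresponding $\delta\equiv\delta_\alpha>0$ such that $$\Delta^{\mathsf{CKL}}_\delta(\phi_{\mathrm{SD}}|y_t,\vartheta_{t|t-1},p_t)<0\quad\Longleftrightarrow\quad p_t(y_t)>f(y_t|\vartheta_{t|t-1}).$$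
   Context: $p_t$ is the true density (on $\mathcal{Y}$) of the observation with realization $y_t$; $f(\cdot|\vartheta)$, $\vartheta\in\Theta$, is a postulated (possibly misspecified) family of densities on $\mathcal{Y}$, whose support contains the support of $p_t$. The score is $s(y,\vartheta)=\frac{\partial}{\partial\vartheta}\log f(y|\vartheta)$. For an updating rule $\phi$, the updated parameter is $\vartheta_{t|t}=\vartheta_{t|t}(y_t)=\phi(y_t,\vartheta_{t|t-1})$. Censored KL. For $\delta>0$ let $B=B_\delta(y_t)=\{x\in\mathcal{Y}:|x-y_t|\le\delta\}$ and $B^c=\mathcal{Y}\setminus B$. For a parameter value $\vartheta$ set $$\mathsf{CKL}_B(p_t\Vert f(\cdot|\vartheta)):=\int_B\log\Big(\frac{p_t(x)}{f(x|\vartheta)}\Big)p_t(x)\,dx+\log\Big(\frac{\int_{B^c}p_t(x)\,dx}{\int_{B^c}f(x|\vartheta)\,dx}\Big)\int_{B^c}p_t(x)\,dx,$$ and $$\Delta^{\mathsf{CKL}}_\delta(\phi|y_t,\vartheta_{t|t-1},p_t):=\mathsf{CKL}_{B_\delta(y_t)}(p_t\Vert f(\cdot|\vartheta_{t|t}))-\mathsf{CKL}_{B_\delta(y_t)}(p_t\Vert f(\cdot|\vartheta_{t|t-1})).$$ *)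

theory Defs
  imports "HOL-Analysis.Analysis"
begin

definition density_on :: "real set \<Rightarrow> (real \<Rightarrow> real) \<Rightarrow> bool" where
  "density_on Y g \<longleftrightarrow>
     (\<forall>x\<in>Y. 0 \<le> g x) \<and> set_integrable lborel Y g \<and> (LINT x:Y|lborel. g x) = 1"

text \<open>A family of densities is a function \<open>f\<close> with \<open>f x \<theta>\<close> standing for \<open>f(x|\<theta>)\<close>.\<close>

definition score :: "(real \<Rightarrow> real \<Rightarrow> real) \<Rightarrow> real \<Rightarrow> real \<Rightarrow> real" where
  "score f y \<theta> = deriv (\<lambda>\<theta>'. ln (f y \<theta>')) \<theta>"

definition phi_SD :: "(real \<Rightarrow> real \<Rightarrow> real) \<Rightarrow> real \<Rightarrow> real \<Rightarrow> real \<Rightarrow> real" where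
  "phi_SD f \<alpha> y \<theta> = \<theta> + \<alpha> * score f y \<theta>"

definition C2_on :: "real set \<Rightarrow> (real \<Rightarrow> real) \<Rightarrow> bool" where
  "C2_on S g \<longleftrightarrow> g C1_differentiable_on S \<and> deriv g C1_differentiable_on S"

definition nbhd :: "real set \<Rightarrow> real \<Rightarrow> real \<Rightarrow> real set" where
  "nbhd Y \<delta> y = {x\<in>Y. \<bar>x - y\<bar> \<le> \<delta>}"

text \<open>
  Complements are taken within \<open>Y\<close>. Since \<open>ln 0 = 0\<close> and \<open>a / 0 = 0\<close>, the usual
  conventions \<open>0 log (0 / q) = 0\<close> (where \<open>p\<close> vanishes) and \<open>0 log (0 / 0) = 0\<close>
  (when \<open>Y - B\<close> is a null set) hold automatically. For \<open>q\<close> positive on \<open>Y\<close> with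
  Lipschitz logarithm, \<open>p\<close> a bounded density on \<open>Y\<close> and \<open>B\<close> bounded and measurable, all
  integrals converge, and the denominator vanishes only if \<open>Y - B\<close> is a null set.
\<close>

definition CKL :: "real set \<Rightarrow> real set \<Rightarrow> (real \<Rightarrow> real) \<Rightarrow> (real \<Rightarrow> real) \<Rightarrow> real" where
  "CKL Y B p q =
     (LINT x:B|lborel. ln (p x / q x) * p x)
     + ln ((LINT x:(Y - B)|lborel. p x) / (LINT x:(Y - B)|lborel. q x))
       * (LINT x:(Y - B)|lborel. p x)"

definition Delta_CKL ::
  "real set \<Rightarrow> (real \<Rightarrow> real \<Rightarrow> real) \<Rightarrow> real \<Rightarrow> (real \<Rightarrow> real \<Rightarrow> real)
     \<Rightarrow> real \<Rightarrow> real \<Rightarrow> (real \<Rightarrow> real) \<Rightarrow> real" where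
  "Delta_CKL Y f \<delta> \<phi> y \<theta> p =
     CKL Y (nbhd Y \<delta> y) p (\<lambda>x. f x (\<phi> y \<theta>)) - CKL Y (nbhd Y \<delta> y) p (\<lambda>x. f x \<theta>)"

end

theory Submission imports Defs "HOL-Real_Asymp.Real_Asymp" begin

text \<open>
  Fix the update and shrink the censoring window. Outside a window \<open>B\<close> of half-width \<open>\<delta>\<close> a
  density has mass \<open>1 - \<integral>\<^sub>B q\<close>, so the censored term of the divergence is governed by
  \<open>ln (1 - \<integral>\<^sub>B q) \<approx> - 2 * \<delta> * q y\<close>. Replacing \<open>q\<^sub>0\<close> by \<open>q\<^sub>1\<close> thus changes the divergence by
  \<open>2 * \<delta> * (q\<^sub>1 y - q\<^sub>0 y - p y * ln (q\<^sub>1 y / q\<^sub>0 y))\<close> up to \<open>o(\<delta>)\<close>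
  (lemma \<open>CKL_change_asymptotics\<close>): raising the density at \<open>y\<close> gains likelihood inside the window,
  and costs mass outside it.

  A small score step strictly raises the density at \<open>y\<close>, since the derivative of the
  log-likelihood along the step is the squared score. As \<open>ln\<close> lies between its tangent bounds, the
  bracket is negative when \<open>q\<^sub>0 y < q\<^sub>1 y < p y\<close> and positive when \<open>p y < q\<^sub>0 y < q\<^sub>1 y\<close>. In the
  first case the step has to be short enough not to overshoot \<open>p y\<close>
  (lemma \<open>small_score_step\<close>). The window is chosen last, depending on the step.
\<close>

section \<open>Integrals over shrinking windows\<close>

lemma window_average_tendsto:
  fixes g :: "real \<Rightarrow> real"
  assumes "open Y" "y \<in> Y" "continuous_on Y g"
  shows "((\<lambda>\<delta>. (LINT x:{y-\<delta>..y+\<delta>}|lborel. g x) / (2 * \<delta>)) \<longlongrightarrow> g y) (at_right 0)"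
proof (rule tendstoI)
  fix e :: real assume "e > 0"
  have "isCont g y"
    using assms continuous_on_eq_continuous_at by blast
  then obtain d1 where d1: "d1 > 0" "\<And>x. \<bar>x - y\<bar> < d1 \<Longrightarrow> \<bar>g x - g y\<bar> < e / 2"
    using \<open>e > 0\<close> unfolding continuous_at_eps_delta dist_real_def
    by (metis half_gt_zero)
  obtain d2 where d2: "d2 > 0" "ball y d2 \<subseteq> Y"
    using assms open_contains_ball by blast
  have "dist ((LINT x:{y-\<delta>..y+\<delta>}|lborel. g x) / (2 * \<delta>)) (g y) < e"
    if "0 < \<delta>" "\<delta> < min d1 d2" for \<delta>
  proof -
    let ?B = "{y-\<delta>..y+\<delta>}"
    have "?B \<subseteq> Y" using that d2 by (auto simp: dist_real_def subset_iff)
    then have int: "set_integrable lborel ?B g"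
      by (intro borel_integrable_atLeastAtMost' continuous_on_subset[OF assms(3)])
    have const: "set_integrable lborel ?B (\<lambda>x. c)" "(LINT x:?B|lborel. c) = 2 * \<delta> * c" for c :: real
      using that by (auto intro!: borel_integrable_atLeastAtMost' simp: set_integral_const)
    have near: "\<bar>g x - g y\<bar> < e / 2" if "x \<in> ?B" for x
      using that \<open>\<delta> < min d1 d2\<close> by (intro d1) auto
    have bound: "g x \<le> g y + e / 2" "g y - e / 2 \<le> g x" if "x \<in> ?B" for x
      using near[OF that] by arith+
    have "(LINT x:?B|lborel. g x) \<le> (LINT x:?B|lborel. g y + e / 2)"
      by (intro set_integral_mono int const)
         (rule bound, assumption)
    moreover have "(LINT x:?B|lborel. g y - e / 2) \<le> (LINT x:?B|lborel. g x)"
      by (intro set_integral_mono int const)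
         (rule bound, assumption)
    ultimately have "\<bar>(LINT x:?B|lborel. g x) / (2 * \<delta>) - g y\<bar> \<le> e / 2"
      using that unfolding const by (simp add: abs_le_iff field_simps)
    then show ?thesis using \<open>e > 0\<close> by (simp add: dist_real_def)
  qed
  then show "\<forall>\<^sub>F \<delta> in at_right 0.
      dist ((LINT x:{y-\<delta>..y+\<delta>}|lborel. g x) / (2 * \<delta>)) (g y) < e"
    using d1 d2 by (auto simp: eventually_at_right_field intro!: exI[of _ "min d1 d2"])
qed

lemma tendsto_ln_one_minus_div:
  fixes u :: "real \<Rightarrow> real"
  assumes "((\<lambda>\<delta>. u \<delta> / (2 * \<delta>)) \<longlongrightarrow> c) (at_right 0)"
  shows "(u \<longlongrightarrow> 0) (at_right 0)"
    and "((\<lambda>\<delta>. ln (1 - u \<delta>) / (2 * \<delta>)) \<longlongrightarrow> - c) (at_right 0)"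
proof -
  have "((\<lambda>\<delta>. u \<delta> / (2 * \<delta>) * (2 * \<delta>)) \<longlongrightarrow> c * (2 * 0)) (at_right 0)"
    by (intro tendsto_intros assms)
  moreover have "\<forall>\<^sub>F \<delta> in at_right 0. u \<delta> / (2 * \<delta>) * (2 * \<delta>) = u \<delta>"
    using eventually_at_right_less[of 0] by eventually_elim simp
  ultimately show u0: "(u \<longlongrightarrow> 0) (at_right 0)"
    by (auto dest: Lim_transform_eventually)
  \<comment> \<open>Caratheodory's form of the derivative avoids dividing by \<open>u \<delta>\<close>, which may vanish.\<close>
  have "((\<lambda>z::real. ln (1 - z)) has_real_derivative - 1) (at 0)"
    by (auto intro!: derivative_eq_intros)
  then obtain k where k: "\<And>z::real. ln (1 - z) = k z * z" "isCont k 0" "k 0 = - 1"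
    unfolding CARAT_DERIV by auto
  have "((\<lambda>\<delta>. k (u \<delta>) * (u \<delta> / (2 * \<delta>))) \<longlongrightarrow> k 0 * c) (at_right 0)"
    by (intro tendsto_mult assms isCont_tendsto_compose[OF k(2) u0])
  then show "((\<lambda>\<delta>. ln (1 - u \<delta>) / (2 * \<delta>)) \<longlongrightarrow> - c) (at_right 0)"
    by (simp add: k)
qed

section \<open>Change of the censored divergence over a small window\<close>

lemma continuous_on_mult_ln: "continuous_on {0..} (\<lambda>t::real. t * ln t)"
proof -
  have "((\<lambda>t::real. t * ln t) \<longlongrightarrow> 0 * ln 0) (at 0 within {0..})"
  proof -
    have "((\<lambda>t::real. t * ln t) \<longlongrightarrow> 0) (at_right 0)"
      by real_asymp
    then show ?thesis
      by (simp add: at_within_Ici_at_right)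
  qed
  moreover have "isCont (\<lambda>t::real. t * ln t) t" if "t > 0" for t
    using that by (intro continuous_intros) auto
  ultimately show ?thesis
    unfolding continuous_on_def
    by (metis atLeast_iff continuous_at_imp_continuous_within continuous_within order_le_less)
qed

text \<open>
  Subtracting two divergences under one integral sign needs each of them to be finite. Since \<open>p\<close> may
  vanish, \<open>ln (p x / q x)\<close> alone need not be bounded, but \<open>t * ln t\<close> extends continuously to \<open>0\<close>.
\<close>

lemma set_integrable_KL_integrand:
  fixes p q :: "real \<Rightarrow> real"
  assumes "continuous_on {a..b} p" "continuous_on {a..b} q"
    and "\<And>x. x \<in> {a..b} \<Longrightarrow> p x \<ge> 0" "\<And>x. x \<in> {a..b} \<Longrightarrow> q x > 0"
  shows "set_integrable lborel {a..b} (\<lambda>x. ln (p x / q x) * p x)"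
proof -
  have "continuous_on {a..b} (\<lambda>x. p x * ln (p x) - ln (q x) * p x)"
    using assms
    by (intro continuous_on_diff continuous_on_compose2[OF continuous_on_mult_ln] continuous_intros)
       force+
  moreover have "ln (p x / q x) * p x = p x * ln (p x) - ln (q x) * p x" if "x \<in> {a..b}" for x
    using assms(3,4)[OF that] by (cases "p x = 0") (auto simp: ln_div algebra_simps)
  ultimately have "continuous_on {a..b} (\<lambda>x. ln (p x / q x) * p x)"
    by (subst continuous_on_cong[OF refl]) auto
  then show ?thesis
    by (rule borel_integrable_atLeastAtMost')
qed

lemma density_on_complement:
  assumes "density_on Y q" "open Y" "{a..b} \<subseteq> Y"
  shows "(LINT x:(Y - {a..b})|lborel. q x) = 1 - (LINT x:{a..b}|lborel. q x)"
proof -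
  have int: "set_integrable lborel Y q" "(LINT x:Y|lborel. q x) = 1"
    using assms by (auto simp: density_on_def)
  have "(LINT x:({a..b} \<union> (Y - {a..b}))|lborel. q x)
      = (LINT x:{a..b}|lborel. q x) + (LINT x:(Y - {a..b})|lborel. q x)"
    by (intro set_integral_Un set_integrable_subset[OF int(1)]) (use assms in auto)
  moreover have "{a..b} \<union> (Y - {a..b}) = Y"
    using assms by auto
  ultimately show ?thesis
    using int by simp
qed

text \<open>
  The terms containing only \<open>p\<close> cancel in the difference. What remains is the log-likelihood
  ratio weighted by \<open>p\<close> over the window, and the difference of the log masses outside it.
\<close>

lemma CKL_change:
  assumes dens: "density_on Y p" "density_on Y q0" "density_on Y q1"
    and cont: "continuous_on Y p" "continuous_on Y q0" "continuous_on Y q1"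
    and pos: "\<And>x. x \<in> Y \<Longrightarrow> q0 x > 0" "\<And>x. x \<in> Y \<Longrightarrow> q1 x > 0"
    and Y: "open Y" and sub: "{a..b} \<subseteq> Y"
    and less: "(LINT x:{a..b}|lborel. p x) < 1" "(LINT x:{a..b}|lborel. q0 x) < 1"
      "(LINT x:{a..b}|lborel. q1 x) < 1"
  shows "CKL Y {a..b} p q1 - CKL Y {a..b} p q0
    = (1 - (LINT x:{a..b}|lborel. p x))
        * (ln (1 - (LINT x:{a..b}|lborel. q0 x)) - ln (1 - (LINT x:{a..b}|lborel. q1 x)))
      - (LINT x:{a..b}|lborel. p x * ln (q1 x / q0 x))"
proof -
  have p0: "p x \<ge> 0" if "x \<in> Y" for x
    using dens that by (auto simp: density_on_def)
  have int: "set_integrable lborel {a..b} (\<lambda>x. ln (p x / q x) * p x)"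
    if "continuous_on Y q" "\<And>x. x \<in> Y \<Longrightarrow> q x > 0" for q
    using that p0 sub
    by (intro set_integrable_KL_integrand continuous_on_subset[OF cont(1)] continuous_on_subset[OF that(1)])
       auto
  have "(LINT x:{a..b}|lborel. ln (p x / q1 x) * p x) - (LINT x:{a..b}|lborel. ln (p x / q0 x) * p x)
      = (LINT x:{a..b}|lborel. ln (p x / q1 x) * p x - ln (p x / q0 x) * p x)"
    by (rule set_integral_diff(2)[symmetric]) (intro int cont pos; assumption)+
  also have "\<dots> = (LINT x:{a..b}|lborel. - (p x * ln (q1 x / q0 x)))"
  proof (rule set_lebesgue_integral_cong)
    show "\<forall>x. x \<in> {a..b} \<longrightarrow>
        ln (p x / q1 x) * p x - ln (p x / q0 x) * p x = - (p x * ln (q1 x / q0 x))"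
    proof (intro allI impI)
      fix x assume "x \<in> {a..b}"
      then have "x \<in> Y" using sub by auto
      then show "ln (p x / q1 x) * p x - ln (p x / q0 x) * p x = - (p x * ln (q1 x / q0 x))"
        using p0[of x] pos[of x] by (cases "p x = 0") (auto simp: ln_div algebra_simps)
    qed
  qed simp
  finally have inside: "(LINT x:{a..b}|lborel. ln (p x / q1 x) * p x)
      - (LINT x:{a..b}|lborel. ln (p x / q0 x) * p x)
      = - (LINT x:{a..b}|lborel. p x * ln (q1 x / q0 x))"
    by (simp add: set_lebesgue_integral_def)
  show ?thesis
    using less inside unfolding CKL_def
    by (simp add: density_on_complement[OF _ Y sub] dens ln_div algebra_simps)
qed

lemma CKL_change_asymptotics:
  assumes dens: "density_on Y p" "density_on Y q0" "density_on Y q1"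
    and cont: "continuous_on Y p" "continuous_on Y q0" "continuous_on Y q1"
    and pos: "\<And>x. x \<in> Y \<Longrightarrow> q0 x > 0" "\<And>x. x \<in> Y \<Longrightarrow> q1 x > 0"
    and Y: "open Y" and y: "y \<in> Y"
  shows "((\<lambda>\<delta>. (CKL Y (nbhd Y \<delta> y) p q1 - CKL Y (nbhd Y \<delta> y) p q0) / (2 * \<delta>))
    \<longlongrightarrow> q1 y - q0 y - p y * ln (q1 y / q0 y)) (at_right 0)"
proof -
  define I where "I g \<delta> = (LINT x:{y-\<delta>..y+\<delta>}|lborel. g x)" for g :: "real \<Rightarrow> real" and \<delta>
  have avg: "((\<lambda>\<delta>. I g \<delta> / (2 * \<delta>)) \<longlongrightarrow> g y) (at_right 0)" if "continuous_on Y g" for g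
    using window_average_tendsto[OF Y y that] by (simp add: I_def)
  have I0: "(I g \<longlongrightarrow> 0) (at_right 0)" if "continuous_on Y g" for g
    using tendsto_ln_one_minus_div(1)[OF avg[OF that]] .
  have lnI: "((\<lambda>\<delta>. ln (1 - I g \<delta>) / (2 * \<delta>)) \<longlongrightarrow> - g y) (at_right 0)" if "continuous_on Y g" for g
    using tendsto_ln_one_minus_div(2)[OF avg[OF that]] .
  have cont_ratio: "continuous_on Y (\<lambda>x. p x * ln (q1 x / q0 x))"
    using pos by (intro continuous_intros cont) (auto simp: less_imp_neq[symmetric])
  have "((\<lambda>\<delta>. (1 - I p \<delta>) * (ln (1 - I q0 \<delta>) / (2 * \<delta>) - ln (1 - I q1 \<delta>) / (2 * \<delta>))
      - I (\<lambda>x. p x * ln (q1 x / q0 x)) \<delta> / (2 * \<delta>))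
      \<longlongrightarrow> (1 - 0) * (- q0 y - - q1 y) - p y * ln (q1 y / q0 y)) (at_right 0)"
    by (intro tendsto_diff tendsto_mult tendsto_const I0 lnI cont avg[OF cont_ratio])
  then have lim: "((\<lambda>\<delta>. ((1 - I p \<delta>) * (ln (1 - I q0 \<delta>) - ln (1 - I q1 \<delta>))
      - I (\<lambda>x. p x * ln (q1 x / q0 x)) \<delta>) / (2 * \<delta>))
      \<longlongrightarrow> q1 y - q0 y - p y * ln (q1 y / q0 y)) (at_right 0)"
    by (simp add: diff_divide_distrib right_diff_distrib)
  obtain d where d: "d > 0" "ball y d \<subseteq> Y"
    using Y y open_contains_ball by blast
  have "\<forall>\<^sub>F \<delta> in at_right 0. \<delta> < d"
    using d by (auto simp: eventually_at_right_field)
  moreover have "\<forall>\<^sub>F \<delta> in at_right 0. I p \<delta> < 1"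
    "\<forall>\<^sub>F \<delta> in at_right 0. I q0 \<delta> < 1" "\<forall>\<^sub>F \<delta> in at_right 0. I q1 \<delta> < 1"
    using order_tendstoD(2)[OF I0, of _ 1] cont by auto
  ultimately have "\<forall>\<^sub>F \<delta> in at_right 0.
      ((1 - I p \<delta>) * (ln (1 - I q0 \<delta>) - ln (1 - I q1 \<delta>))
        - I (\<lambda>x. p x * ln (q1 x / q0 x)) \<delta>) / (2 * \<delta>)
      = (CKL Y (nbhd Y \<delta> y) p q1 - CKL Y (nbhd Y \<delta> y) p q0) / (2 * \<delta>)"
  proof eventually_elim
    case (elim \<delta>)
    have sub: "{y-\<delta>..y+\<delta>} \<subseteq> Y"
      using elim d by (auto simp: dist_real_def subset_iff)
    then have "nbhd Y \<delta> y = {y-\<delta>..y+\<delta>}"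
      by (auto simp: nbhd_def abs_le_iff)
    then show ?case
      using CKL_change[OF dens cont pos Y sub] elim by (simp add: I_def)
  qed
  then show ?thesis
    by (rule Lim_transform_eventually[OF lim])
qed

section \<open>Sign of the leading coefficient\<close>

text \<open>
  The numbers \<open>c\<close>, \<open>r\<close> and \<open>a\<close> stand for the old, the new and the true density at the observation:
  \<open>a * ln (r / c)\<close> is the likelihood gained inside the window, \<open>r - c\<close> the mass lost outside it. The
  tangent bounds \<open>(r - c) / r \<le> ln (r / c) \<le> (r - c) / c\<close> compare the two.
\<close>

lemma gain_exceeds_cost:
  fixes c r a :: real
  assumes "0 < c" "c < r" "r < a"
  shows "r - c - a * ln (r / c) < 0"
proof -
  have "ln (c / r) \<le> c / r - 1"
    using assms by (intro ln_le_minus_one) auto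
  then have "(r - c) / r \<le> ln (r / c)"
    using assms by (simp add: ln_div field_simps)
  then have "a * ((r - c) / r) \<le> a * ln (r / c)"
    using assms by (intro mult_left_mono) auto
  moreover have "r - c < a * ((r - c) / r)"
    using assms by (simp add: pos_less_divide_eq mult.commute)
  ultimately show ?thesis by linarith
qed

lemma cost_exceeds_gain:
  fixes c r a :: real
  assumes "0 \<le> a" "a < c" "c < r"
  shows "r - c - a * ln (r / c) > 0"
proof -
  have "ln (r / c) \<le> r / c - 1"
    using assms by (intro ln_le_minus_one) auto
  then have "ln (r / c) \<le> (r - c) / c"
    using assms by (simp add: field_simps)
  then have "a * ln (r / c) \<le> a * ((r - c) / c)"
    using assms by (intro mult_left_mono) auto
  moreover have "a * ((r - c) / c) < r - c"
    using assms by (simp add: pos_divide_less_eq mult.commute)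
  ultimately show ?thesis by linarith
qed

section \<open>Small score steps\<close>

text \<open>
  As a function of the learning rate the log-likelihood starts with slope \<open>(score f y \<theta>)\<^sup>2 > 0\<close>, so
  it increases at first; by continuity it does not overshoot a level \<open>b\<close> above the current density.
\<close>

lemma small_score_step:
  assumes Theta: "open \<Theta>" "\<theta> \<in> \<Theta>"
    and C2: "C2_on \<Theta> (\<lambda>t. ln (f y t))"
    and pos: "\<And>t. t \<in> \<Theta> \<Longrightarrow> f y t > 0"
    and score: "score f y \<theta> \<noteq> 0"
    and b: "f y \<theta> < b"
  obtains \<alpha> where "\<alpha> > 0" "phi_SD f \<alpha> y \<theta> \<in> \<Theta>"
    "f y \<theta> < f y (phi_SD f \<alpha> y \<theta>)" "f y (phi_SD f \<alpha> y \<theta>) < b"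
proof -
  define s where "s = score f y \<theta>"
  have "(\<lambda>t. ln (f y t)) differentiable at \<theta>"
    using C2 Theta by (auto simp: C2_on_def C1_differentiable_on_eq)
  then have der: "((\<lambda>t. ln (f y t)) has_real_derivative s) (at \<theta>)"
    unfolding s_def score_def
    using DERIV_deriv_iff_real_differentiable by blast
  have line: "((\<lambda>\<alpha>. \<theta> + \<alpha> * s) has_real_derivative s) (at 0)"
    by (auto intro!: derivative_eq_intros)
  have along: "((\<lambda>\<alpha>. ln (f y (\<theta> + \<alpha> * s))) has_real_derivative s * s) (at 0)"
    using DERIV_chain2[of "\<lambda>t. ln (f y t)" s "\<lambda>\<alpha>. \<theta> + \<alpha> * s", OF _ line] der by simp
  have "s * s > 0"
    using score by (auto simp: s_def zero_less_mult_iff)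
  then have up: "\<forall>\<^sub>F \<alpha> in at_right 0. ln (f y \<theta>) < ln (f y (\<theta> + \<alpha> * s))"
    using DERIV_pos_inc_right[OF along] by (auto simp: eventually_at_right_field)
  have "((\<lambda>\<alpha>. ln (f y (\<theta> + \<alpha> * s))) \<longlongrightarrow> ln (f y (\<theta> + 0 * s))) (at_right 0)"
    using DERIV_isCont[OF along] by (simp add: isCont_def filterlim_at_split)
  moreover have "ln (f y (\<theta> + 0 * s)) < ln b"
    using b pos[OF Theta(2)] by simp
  ultimately have low: "\<forall>\<^sub>F \<alpha> in at_right 0. ln (f y (\<theta> + \<alpha> * s)) < ln b"
    by (rule order_tendstoD(2))
  have "((\<lambda>\<alpha>. \<theta> + \<alpha> * s) \<longlongrightarrow> \<theta> + 0 * s) (at_right 0)"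
    by (intro tendsto_intros)
  then have mem: "\<forall>\<^sub>F \<alpha> in at_right 0. \<theta> + \<alpha> * s \<in> \<Theta>"
    using Theta by (intro topological_tendstoD) auto
  have "\<forall>\<^sub>F \<alpha> in at_right 0. \<alpha> > 0 \<and> \<theta> + \<alpha> * s \<in> \<Theta> \<and> ln (f y \<theta>) < ln (f y (\<theta> + \<alpha> * s))
      \<and> ln (f y (\<theta> + \<alpha> * s)) < ln b"
    using eventually_at_right_less[of 0] up low mem by eventually_elim simp
  then obtain \<alpha> where "\<alpha> > 0" "\<theta> + \<alpha> * s \<in> \<Theta>" "ln (f y \<theta>) < ln (f y (\<theta> + \<alpha> * s))"
      "ln (f y (\<theta> + \<alpha> * s)) < ln b"
    using eventually_happens'[OF trivial_limit_at_right_real] by blast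
  moreover have "b > 0"
    using b pos[OF Theta(2)] by linarith
  ultimately show ?thesis
    using that pos Theta(2) by (force simp: phi_SD_def s_def)
qed

lemma continuous_on_of_ln_lipschitz:
  fixes q :: "real \<Rightarrow> real"
  assumes "L-lipschitz_on Y (\<lambda>x. ln (q x))" "\<And>x. x \<in> Y \<Longrightarrow> q x > 0"
  shows "continuous_on Y q"
proof -
  have "continuous_on Y (\<lambda>x. exp (ln (q x)))"
    by (intro continuous_on_exp lipschitz_on_continuous_on[OF assms(1)])
  then show ?thesis
    using assms(2) by (simp cong: continuous_on_cong)
qed

section \<open>The score-driven update\<close>

theorem theoremH1:
  fixes Y \<Theta> :: "real set"
    and f :: "real \<Rightarrow> real \<Rightarrow> real"
    and P :: "(real \<Rightarrow> real) set"
    and y \<theta> :: real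
    and p :: "real \<Rightarrow> real"
  assumes Y: "open Y" "convex Y"
    and Theta: "open \<Theta>" "convex \<Theta>"
    and f_density: "\<And>\<theta>'. \<theta>' \<in> \<Theta> \<Longrightarrow> density_on Y (\<lambda>x. f x \<theta>')"
    and f_pos: "\<And>x \<theta>'. x \<in> Y \<Longrightarrow> \<theta>' \<in> \<Theta> \<Longrightarrow> f x \<theta>' > 0"
    and f_C2: "\<And>x. x \<in> Y \<Longrightarrow> C2_on \<Theta> (\<lambda>\<theta>'. ln (f x \<theta>'))"
    and f_Lipschitz: "\<And>\<theta>'. \<theta>' \<in> \<Theta> \<Longrightarrow> \<exists>L. L-lipschitz_on Y (\<lambda>x. ln (f x \<theta>'))"
    and P_density: "\<And>p'. p' \<in> P \<Longrightarrow> density_on Y p'"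
    and P_Lipschitz: "\<And>p'. p' \<in> P \<Longrightarrow> \<exists>L. L-lipschitz_on Y p'"
    and P_bounded: "\<And>p'. p' \<in> P \<Longrightarrow> bounded (p' ` Y)"
    and y: "y \<in> Y"
    and theta: "\<theta> \<in> \<Theta>"
    and p: "p \<in> P"
    and nonzero: "(p y - f y \<theta>) * score f y \<theta> \<noteq> 0"
  shows "\<exists>\<alpha>>0. phi_SD f \<alpha> y \<theta> \<in> \<Theta> \<and>
           (\<exists>\<delta>>0. Delta_CKL Y f \<delta> (phi_SD f \<alpha>) y \<theta> p < 0 \<longleftrightarrow> p y > f y \<theta>)"
proof -
  have s: "score f y \<theta> \<noteq> 0" and neq: "p y \<noteq> f y \<theta>"
    using nonzero by auto
  have p0: "p y \<ge> 0"
    using P_density[OF p] y by (auto simp: density_on_def)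
  \<comment> \<open>If \<open>p y < f y \<theta>\<close> no overshooting can occur, and the value \<open>f y \<theta> + 1\<close> is arbitrary.\<close>
  define b where "b = (if p y > f y \<theta> then p y else f y \<theta> + 1)"
  have "f y \<theta> < b" by (simp add: b_def)
  then obtain \<alpha> where \<alpha>: "\<alpha> > 0" "phi_SD f \<alpha> y \<theta> \<in> \<Theta>"
      "f y \<theta> < f y (phi_SD f \<alpha> y \<theta>)" "f y (phi_SD f \<alpha> y \<theta>) < b"
    using small_score_step[OF Theta(1) theta f_C2[OF y] f_pos[OF y] s] by metis
  define q0 where "q0 = (\<lambda>x. f x \<theta>)"
  define q1 where "q1 = (\<lambda>x. f x (phi_SD f \<alpha> y \<theta>))"
  define l where "l = q1 y - q0 y - p y * ln (q1 y / q0 y)"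
  have cont_f: "continuous_on Y (\<lambda>x. f x t)" if t: "t \<in> \<Theta>" for t
  proof -
    obtain L where "L-lipschitz_on Y (\<lambda>x. ln (f x t))"
      using f_Lipschitz[OF t] by blast
    then show ?thesis
      by (rule continuous_on_of_ln_lipschitz) (rule f_pos[OF _ t])
  qed
  have cont_p: "continuous_on Y p"
    using P_Lipschitz[OF p] lipschitz_on_continuous_on by blast
  have "((\<lambda>\<delta>. (CKL Y (nbhd Y \<delta> y) p q1 - CKL Y (nbhd Y \<delta> y) p q0) / (2 * \<delta>)) \<longlongrightarrow> l)
      (at_right 0)"
    unfolding l_def
    by (rule CKL_change_asymptotics[OF P_density[OF p] _ _ cont_p _ _ _ _ Y(1) y])
       (use f_density cont_f f_pos theta \<alpha> in \<open>auto simp: q0_def q1_def\<close>)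
  then have lim: "((\<lambda>\<delta>. Delta_CKL Y f \<delta> (phi_SD f \<alpha>) y \<theta> p / (2 * \<delta>)) \<longlongrightarrow> l) (at_right 0)"
    by (simp add: Delta_CKL_def q0_def q1_def)
  have c: "0 < q0 y" "q0 y < q1 y"
    using f_pos[OF y theta] \<alpha> by (simp_all add: q0_def q1_def)
  have "\<forall>\<^sub>F \<delta> in at_right 0. Delta_CKL Y f \<delta> (phi_SD f \<alpha>) y \<theta> p < 0 \<longleftrightarrow> p y > f y \<theta>"
  proof (cases "p y > f y \<theta>")
    case True
    then have "l < 0"
      unfolding l_def using \<alpha>(4) c by (intro gain_exceeds_cost) (auto simp: b_def q1_def)
    from order_tendstoD(2)[OF lim this] eventually_at_right_less[of 0] show ?thesis
      by eventually_elim (use True in \<open>auto simp: divide_less_0_iff\<close>)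
  next
    case False
    then have "l > 0"
      unfolding l_def using neq c p0 by (intro cost_exceeds_gain) (auto simp: q0_def)
    from order_tendstoD(1)[OF lim this] eventually_at_right_less[of 0] show ?thesis
      by eventually_elim (use False in \<open>auto simp: zero_less_divide_iff\<close>)
  qed
  with eventually_at_right_less[of 0]
  have "\<forall>\<^sub>F \<delta> in at_right 0. \<delta> > 0 \<and>
      (Delta_CKL Y f \<delta> (phi_SD f \<alpha>) y \<theta> p < 0 \<longleftrightarrow> p y > f y \<theta>)"
    by (rule eventually_conj)
  then have "\<exists>\<delta>>0. Delta_CKL Y f \<delta> (phi_SD f \<alpha>) y \<theta> p < 0 \<longleftrightarrow> p y > f y \<theta>"
    by (rule eventually_happens'[OF trivial_limit_at_right_real])
  then show ?thesis
    using \<alpha> by blast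
qed

end
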